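(* Let $k\ge 1$ be an integer, let $m\ge 1$ be an odd integer, and let $t_0=a+ib$ with $a,b\in\mathbb{R}$ and $t_0\notin[-1,1]$. Then the integrals $$\widetilde{P}_k^m(t_0):=\int_{-1}^{1}\frac{(t-a)^{k-1}}{|t-t_0|^m}\,dt$$ can be computed via the recurrences $$\widetilde{P}_{k+1}^m(t_0)=\begin{cases}\dfrac{t_2^{k-1}u_2-t_1^{k-1}u_1-(k-1)b^2\,\widetilde{P}_{k-1}^m(t_0)}{k}, & m=1\text{ and }k>1,\\[2mm] \widetilde{P}_{k-1}^{m-2}(t_0)-b^2\,\widetilde{P}_{k-1}^{m}(t_0), & m>1\text{ and }k>1,\end{cases}$$ where $t_1=-1-a$, $t_2=1-a$, and $$u_1=\sqrt{(1+a)^2+b^2}=|1+t_0|,\qquad u_2=\sqrt{(1-a)^2+b^2}=|1-t_0|.$$ Initial values for $m=1,3,5$ are given by $$\widetilde{P}_1^1(t_0)=\operatorname{asinh}\!\left(\frac{t_2}{|b|}\right)-\operatorname{asinh}\!\left(\frac{t_1}{|b|}\right),\qquad \widetilde{P}_2^1(t_0)=u_2-u_1,$$ $$\widetilde{P}_1^3(t_0)=\frac1{b^2}\left(\frac{t_2}{u_2}-\frac{t_1}{u_1}\right),\qquad \widetilde{P}_2^3(t_0)=\frac1{u_1}-\frac1{u_2},$$ $$\widetilde{P}_1^5(t_0)=\frac1{3b^2}\left(\frac{t_2}{u_2^3}-\frac{t_1}{u_1^3}+2\widetilde{P}_1^3(t_0)\right),\qquad \widetilde{P}_2^5(t_0)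=\frac13\left(\frac1{u_1^3}-\frac1{u_2^3}\right).$$
   Context: Here $|t-t_0|$ is the complex modulus, so for real $t$ one has $|t-t_0|^2=(t-a)^2+b^2$. The function $\operatorname{asinh}$ is the real inverse hyperbolic sine.
   Formalization: The closed forms for P̃_1^1, P̃_1^3 and P̃_1^5 are stated only for b ≠ 0, because for real t_0 outside [-1,1] (b = 0) they divide by zero and are undefined; all other formulas are stated for every t_0 outside [-1,1]. *)

theory Defs
  imports "HOL-Analysis.Analysis"
begin

text \<open>
  Meant for \<open>k \<ge> 1\<close> only, since \<open>k - 1\<close> is truncated subtraction on \<^typ>\<open>nat\<close>. The integrand is
  continuous on the interval as long as \<open>t\<^sub>0\<close> does not lie on the segment from \<open>-1\<close> to \<open>1\<close>.
\<close>

definition Ptilde :: "nat \<Rightarrow> nat \<Rightarrow> complex \<Rightarrow> real" where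
  "Ptilde k m t0 =
     integral {-1..1} (\<lambda>t::real. (t - Re t0) ^ (k - 1) / cmod (complex_of_real t - t0) ^ m)"

end

theory Submission
  imports Defs
begin

text \<open>
  With \<open>s = t - a\<close> and \<open>\<rho> = sqrt (s\<^sup>2 + b\<^sup>2)\<close> one has \<open>\<rho>' = s / \<rho>\<close> and \<open>\<rho>\<^sup>2 = s\<^sup>2 + b\<^sup>2\<close>. The case \<open>m > 1\<close>
  is the identity \<open>s\<^sup>2 / \<rho>\<^sup>m = 1 / \<rho>\<^bsup>m-2\<^esup> - b\<^sup>2 / \<rho>\<^sup>m\<close> under the integral sign; every other formula
  integrates the derivative of one of \<open>s\<^bsup>k-1\<^esup> \<rho>\<close>, \<open>arsinh (s / \<bar>b\<bar>)\<close>, \<open>1 / \<rho>\<^sup>n\<close> and \<open>s / \<rho>\<^sup>n\<close>.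
  The last one, whose derivative is \<open>n b\<^sup>2 / \<rho>\<^bsup>n+2\<^esup> - (n-1) / \<rho>\<^sup>n\<close>, yields both \<open>m = 3\<close> and \<open>m = 5\<close>.
\<close>

locale off_segment =
  fixes a b :: real
  assumes notin: "Complex a b \<notin> complex_of_real ` {-1..1}"
begin

definition \<rho> :: "real \<Rightarrow> real" where "\<rho> s = sqrt (s\<^sup>2 + b\<^sup>2)"

text \<open>The exponent \<open>j\<close> stands for k - 1, which avoids truncated subtraction. The
  substitution s = t - a turns the endpoints of the interval into t1 and t2.\<close>

definition P :: "nat \<Rightarrow> nat \<Rightarrow> real" where
  "P j m = integral {-1 - a..1 - a} (\<lambda>s. s ^ j / \<rho> s ^ m)"

lemma Ptilde_eq_P: "Ptilde k m (Complex a b) = P (k - 1) m"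
proof -
  have "Ptilde k m (Complex a b) = integral {-1..1} ((\<lambda>s. s ^ (k - 1) / \<rho> s ^ m) \<circ> (\<lambda>t. t + - a))"
    by (simp add: Ptilde_def \<rho>_def cmod_def o_def)
  also have "\<dots> = P (k - 1) m"
    using integral_shift_real_ivl[of "-1 - a" "- a" "1 - a" "\<lambda>s. s ^ (k - 1) / \<rho> s ^ m"]
    by (simp add: P_def o_def)
  finally show ?thesis .
qed

lemma \<rho>_square: "\<rho> s ^ 2 = s\<^sup>2 + b\<^sup>2"
  by (simp add: \<rho>_def)

text \<open>If b = 0 and s = 0 lay in the shifted interval, then t0 = a would be a real point of
  [-1, 1]. This is where \<open>notin\<close> enters; continuity of the integrands and every
  division by \<open>\<rho>\<close> rest on it.\<close>

lemma \<rho>_pos: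
  assumes "s \<in> {-1 - a..1 - a}"
  shows "\<rho> s > 0"
proof -
  have "b \<noteq> 0 \<or> s \<noteq> 0"
  proof (rule ccontr)
    assume "\<not> (b \<noteq> 0 \<or> s \<noteq> 0)"
    then have "Complex a b = complex_of_real a" "a \<in> {-1..1}"
      using assms by (auto simp: complex_eq_iff)
    then show False
      using notin by blast
  qed
  then show ?thesis
    by (auto simp: \<rho>_def add_pos_nonneg add_nonneg_pos)
qed

lemma \<rho>_DERIV:
  assumes "s \<in> {-1 - a..1 - a}"
  shows "(\<rho> has_real_derivative s / \<rho> s) (at s within A)"
proof -
  have "s\<^sup>2 + b\<^sup>2 > 0"
    using \<rho>_pos[OF assms] by (simp add: \<rho>_def)
  then show ?thesis
    unfolding \<rho>_def by (auto intro!: derivative_eq_intros simp: field_simps)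
qed

lemma P_has_integral:
  "((\<lambda>s. s ^ j / \<rho> s ^ m) has_integral P j m) {-1 - a..1 - a}"
proof -
  have "continuous_on {-1 - a..1 - a} \<rho>"
    unfolding \<rho>_def by (intro continuous_intros)
  then have "continuous_on {-1 - a..1 - a} (\<lambda>s. s ^ j / \<rho> s ^ m)"
    using \<rho>_pos by (intro continuous_intros) (auto simp: less_imp_neq[symmetric])
  then show ?thesis
    unfolding P_def by (intro integrable_integral integrable_continuous_real)
qed

lemma FTC:
  assumes "\<And>s. s \<in> {-1 - a..1 - a} \<Longrightarrow>
    (F has_real_derivative f s) (at s within {-1 - a..1 - a})"
  shows "(f has_integral F (1 - a) - F (-1 - a)) {-1 - a..1 - a}"
  using assms by (intro fundamental_theorem_of_calculus)
    (auto simp: has_real_derivative_iff_has_vector_derivative)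

lemma inverse_power_\<rho>_DERIV:
  assumes "s \<in> {-1 - a..1 - a}"
  shows "((\<lambda>s. 1 / \<rho> s ^ n) has_real_derivative - (real n * (s / \<rho> s ^ (n + 2)))) (at s within A)"
\<comment> \<open>\<open>DERIV_power_Suc\<close> wants a successor exponent; for n = 0 the function
  is constant and both sides are 0.\<close>
proof (cases n)
  case (Suc k)
  show ?thesis
    unfolding Suc using \<rho>_pos[OF assms]
    by (intro DERIV_cong[OF DERIV_divide[OF DERIV_const DERIV_power_Suc[OF \<rho>_DERIV[OF assms]]]])
      (auto simp: field_simps)
qed simp

lemma P_arsinh:
  assumes "b \<noteq> 0"
  shows "P 0 1 = arsinh ((1 - a) / \<bar>b\<bar>) - arsinh ((-1 - a) / \<bar>b\<bar>)"
proof -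
  \<comment> \<open>The powers \<open>s ^ 0\<close> and \<open>\<rho> s ^ 1\<close> stay
    unsimplified so that the derivative is literally the integrand of \<open>P 0 1\<close>. Since b
    is nonzero, no restriction on s is needed.\<close>
  have "((\<lambda>s. arsinh (s / \<bar>b\<bar>)) has_real_derivative s ^ 0 / \<rho> s ^ 1) (at s within A)" for s A
  proof -
    have "(s / \<bar>b\<bar>)\<^sup>2 + 1 = (s\<^sup>2 + b\<^sup>2) / b\<^sup>2"
      using assms by (simp add: field_simps)
    then have "sqrt ((s / \<bar>b\<bar>)\<^sup>2 + 1) = \<rho> s / \<bar>b\<bar>"
      by (simp add: \<rho>_def real_sqrt_divide)
    moreover have "((\<lambda>s. arsinh (s / \<bar>b\<bar>)) has_real_derivative
        1 / sqrt ((s / \<bar>b\<bar>)\<^sup>2 + 1) * (1 / \<bar>b\<bar>)) (at s within A)"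
      by (intro DERIV_chain2[OF arsinh_real_has_field_derivative] DERIV_cdivide DERIV_ident)
    ultimately show ?thesis
      using assms by simp
  qed
  from has_integral_unique[OF P_has_integral FTC[OF this]] show ?thesis .
qed

text \<open>Integrates the derivative of 1 / \<open>\<rho>\<close>^n. For n = 0 that function is
  constant and the integral is logarithmic instead. The cases n = 1 and n = 3 are used.\<close>

lemma P_1:
  assumes "n > 0"
  shows "P 1 (n + 2) = (1 / \<rho> (-1 - a) ^ n - 1 / \<rho> (1 - a) ^ n) / real n"
proof -
  have "((\<lambda>s. - (real n * (s ^ 1 / \<rho> s ^ (n + 2)))) has_integral - (real n * P 1 (n + 2))) {-1 - a..1 - a}"
    by (intro has_integral_neg has_integral_mult_right P_has_integral)
  then have "- (real n * P 1 (n + 2)) = 1 / \<rho> (1 - a) ^ n - 1 / \<rho> (-1 - a) ^ n"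
    by (rule has_integral_unique) (use FTC[OF inverse_power_\<rho>_DERIV] in simp)
  with assms show ?thesis
    by (simp add: field_simps)
qed

text \<open>Keeping the factor n b^2 on the left makes this valid for b = 0 too. For n = 1 the last
  term vanishes, which gives m = 3; for n = 3 its coefficient is the 2 in the formula for m =
  5.\<close>

lemma P_0:
  "real n * b\<^sup>2 * P 0 (n + 2) =
    (1 - a) / \<rho> (1 - a) ^ n - (-1 - a) / \<rho> (-1 - a) ^ n + (real n - 1) * P 0 n"
proof -
  have "((\<lambda>s. s * (1 / \<rho> s ^ n)) has_real_derivative
      real n * b\<^sup>2 * (s ^ 0 / \<rho> s ^ (n + 2)) - (real n - 1) * (s ^ 0 / \<rho> s ^ n)) (at s within A)"
    if s: "s \<in> {-1 - a..1 - a}" for s A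
  proof -
    \<comment> \<open>As multiples of q all terms have polynomial coefficients in s and b, so the
      identity becomes polynomial.\<close>
    define q where "q = 1 / \<rho> s ^ (n + 2)"
    have q: "1 / \<rho> s ^ n = (s\<^sup>2 + b\<^sup>2) * q" "s / \<rho> s ^ (n + 2) = s * q"
      using \<rho>_pos[OF s] by (simp_all add: \<rho>_square[symmetric] power2_eq_square[of "\<rho> s"] q_def)
    have "- (real n * (s / \<rho> s ^ (n + 2))) * s + 1 / \<rho> s ^ n =
        real n * b\<^sup>2 * (1 / \<rho> s ^ (n + 2)) - (real n - 1) * (1 / \<rho> s ^ n)"
      unfolding q q_def[symmetric] by (simp add: algebra_simps power2_eq_square)
    then show ?thesis
      by (intro DERIV_cong[OF DERIV_mult[OF DERIV_ident inverse_power_\<rho>_DERIV[OF s]]]) simp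
  qed
  from FTC[OF this]
  have "((\<lambda>s. real n * b\<^sup>2 * (s ^ 0 / \<rho> s ^ (n + 2)) - (real n - 1) * (s ^ 0 / \<rho> s ^ n)) has_integral
      (1 - a) * (1 / \<rho> (1 - a) ^ n) - (-1 - a) * (1 / \<rho> (-1 - a) ^ n)) {-1 - a..1 - a}" .
  moreover have "((\<lambda>s. real n * b\<^sup>2 * (s ^ 0 / \<rho> s ^ (n + 2)) - (real n - 1) * (s ^ 0 / \<rho> s ^ n)) has_integral
      real n * b\<^sup>2 * P 0 (n + 2) - (real n - 1) * P 0 n) {-1 - a..1 - a}"
    by (intro has_integral_diff has_integral_mult_right P_has_integral)
  ultimately have "(1 - a) * (1 / \<rho> (1 - a) ^ n) - (-1 - a) * (1 / \<rho> (-1 - a) ^ n) =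
      real n * b\<^sup>2 * P 0 (n + 2) - (real n - 1) * P 0 n"
    by (rule has_integral_unique)
  then show ?thesis
    by simp
qed

lemma P_1_1: "P 1 1 = \<rho> (1 - a) - \<rho> (-1 - a)"
  using has_integral_unique[OF P_has_integral[of 1 1]] FTC[OF \<rho>_DERIV] by simp

text \<open>The product rule for s^(j+1) \<open>\<rho>\<close> gives (j+1) s^j \<open>\<rho>\<close>
  + s^(j+2) / \<open>\<rho>\<close>. Writing the first \<open>\<rho>\<close> as (s^2 + b^2) /
  \<open>\<rho>\<close> splits this into the integrands of \<open>P (j + 2) 1\<close> and
  \<open>P j 1\<close>.\<close>

lemma P_recurrence_1:
  "real (j + 2) * P (j + 2) 1 =
    (1 - a) ^ (j + 1) * \<rho> (1 - a) - (-1 - a) ^ (j + 1) * \<rho> (-1 - a) - real (j + 1) * b\<^sup>2 * P j 1"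
proof -
  let ?f = "\<lambda>s. real (j + 2) * (s ^ (j + 2) / \<rho> s ^ 1) + real (j + 1) * b\<^sup>2 * (s ^ j / \<rho> s ^ 1)"
  have "((\<lambda>s. s ^ (j + 1) * \<rho> s) has_real_derivative ?f s) (at s within A)"
    if s: "s \<in> {-1 - a..1 - a}" for s A
  proof -
    define q where "q = 1 / \<rho> s"
    have q: "\<rho> s = (s\<^sup>2 + b\<^sup>2) * q" "x / \<rho> s = x * q" for x
      using \<rho>_pos[OF s] by (simp_all add: \<rho>_square[symmetric] power2_eq_square[of "\<rho> s"] q_def)
    \<comment> \<open>\<open>q(2)\<close> goes first to absorb the quotients; the only
      \<open>\<rho> s\<close> then left for \<open>q(1)\<close> is the factor next to s^j.\<close>
    have "real (j + 1) * s ^ j * \<rho> s + s ^ (j + 1) * (s / \<rho> s) = ?f s"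
      unfolding power_one_right q(2) by (subst q(1)) (simp add: algebra_simps power2_eq_square)
    then show ?thesis
      unfolding Suc_eq_plus1[symmetric]
      by (intro DERIV_cong[OF DERIV_mult[OF DERIV_power_Suc[OF DERIV_ident] \<rho>_DERIV[OF s]]])
        (simp add: algebra_simps)
  qed
  from FTC[OF this]
  have "(?f has_integral (1 - a) ^ (j + 1) * \<rho> (1 - a) - (-1 - a) ^ (j + 1) * \<rho> (-1 - a)) {-1 - a..1 - a}" .
  moreover have "(?f has_integral real (j + 2) * P (j + 2) 1 + real (j + 1) * b\<^sup>2 * P j 1) {-1 - a..1 - a}"
    by (intro has_integral_add has_integral_mult_right P_has_integral)
  ultimately have "(1 - a) ^ (j + 1) * \<rho> (1 - a) - (-1 - a) ^ (j + 1) * \<rho> (-1 - a) =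
      real (j + 2) * P (j + 2) 1 + real (j + 1) * b\<^sup>2 * P j 1"
    by (rule has_integral_unique)
  then show ?thesis
    by simp
qed

lemma P_recurrence: "P (j + 2) (n + 2) = P j n - b\<^sup>2 * P j (n + 2)"
proof -
  have "((\<lambda>s. s ^ j / \<rho> s ^ n - b\<^sup>2 * (s ^ j / \<rho> s ^ (n + 2))) has_integral
      P j n - b\<^sup>2 * P j (n + 2)) {-1 - a..1 - a}"
    by (intro has_integral_diff has_integral_mult_right P_has_integral)
  moreover have "s ^ j / \<rho> s ^ n - b\<^sup>2 * (s ^ j / \<rho> s ^ (n + 2)) = s ^ (j + 2) / \<rho> s ^ (n + 2)"
    if s: "s \<in> {-1 - a..1 - a}" for s
  proof -
    have "s ^ j / \<rho> s ^ n = s ^ j * (s\<^sup>2 + b\<^sup>2) / \<rho> s ^ (n + 2)"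
      using \<rho>_pos[OF s] by (simp add: \<rho>_square[symmetric] power2_eq_square[of "\<rho> s"])
    then have "s ^ j / \<rho> s ^ n - b\<^sup>2 * (s ^ j / \<rho> s ^ (n + 2)) =
        (s ^ j * (s\<^sup>2 + b\<^sup>2) - b\<^sup>2 * s ^ j) / \<rho> s ^ (n + 2)"
      by (simp only: diff_divide_distrib times_divide_eq_right)
    also have "s ^ j * (s\<^sup>2 + b\<^sup>2) - b\<^sup>2 * s ^ j = s ^ (j + 2)"
      by (simp add: algebra_simps power2_eq_square)
    finally show ?thesis .
  qed
  ultimately have "((\<lambda>s. s ^ (j + 2) / \<rho> s ^ (n + 2)) has_integral
      P j n - b\<^sup>2 * P j (n + 2)) {-1 - a..1 - a}"
    by (rule has_integral_eq[rotated])
  from has_integral_unique[OF P_has_integral this] show ?thesis .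
qed

end

theorem lemma3p2:
  fixes k m :: nat and t0 :: complex and a b t1 t2 u1 u2 :: real
  assumes "k \<ge> 1"
    and "m \<ge> 1" and "odd m"
    and "t0 = complex_of_real a + \<i> * complex_of_real b"
    and "t0 \<notin> complex_of_real ` {-1..1}"
    and "t1 = -1 - a" and "t2 = 1 - a"
    and "u1 = sqrt ((1 + a)\<^sup>2 + b\<^sup>2)" and "u2 = sqrt ((1 - a)\<^sup>2 + b\<^sup>2)"
  shows "u1 = cmod (1 + t0) \<and> u2 = cmod (1 - t0)
    \<and> (m = 1 \<and> k > 1 \<longrightarrow>
         Ptilde (k + 1) m t0 =
           (t2 ^ (k - 1) * u2 - t1 ^ (k - 1) * u1 - real (k - 1) * b\<^sup>2 * Ptilde (k - 1) m t0) / real k)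
    \<and> (m > 1 \<and> k > 1 \<longrightarrow>
         Ptilde (k + 1) m t0 = Ptilde (k - 1) (m - 2) t0 - b\<^sup>2 * Ptilde (k - 1) m t0)
    \<and> (b \<noteq> 0 \<longrightarrow> Ptilde 1 1 t0 = arsinh (t2 / \<bar>b\<bar>) - arsinh (t1 / \<bar>b\<bar>))
    \<and> Ptilde 2 1 t0 = u2 - u1
    \<and> (b \<noteq> 0 \<longrightarrow> Ptilde 1 3 t0 = 1 / b\<^sup>2 * (t2 / u2 - t1 / u1))
    \<and> Ptilde 2 3 t0 = 1 / u1 - 1 / u2
    \<and> (b \<noteq> 0 \<longrightarrow>
         Ptilde 1 5 t0 = 1 / (3 * b\<^sup>2) * (t2 / u2 ^ 3 - t1 / u1 ^ 3 + 2 * Ptilde 1 3 t0))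
    \<and> Ptilde 2 5 t0 = 1 / 3 * (1 / u1 ^ 3 - 1 / u2 ^ 3)"
proof -
  have t0: "t0 = Complex a b"
    using assms(4) by (simp add: complex_eq_iff)
  interpret off_segment a b
    using assms(5) by unfold_locales (simp add: t0)
  \<comment> \<open>Only a sign inside the square differs: t1 = -(1 + a).\<close>
  have u: "u1 = \<rho> t1" "u2 = \<rho> t2"
    by (simp_all add: assms(6-9) \<rho>_def power2_eq_square algebra_simps)
  have "u1 = cmod (1 + t0)" "u2 = cmod (1 - t0)"
    using assms by (simp_all add: t0 cmod_def)
  moreover have "Ptilde (k + 1) m t0 =
      (t2 ^ (k - 1) * u2 - t1 ^ (k - 1) * u1 - real (k - 1) * b\<^sup>2 * Ptilde (k - 1) m t0) / real k"
    if "m = 1" "k > 1"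
  proof -
    \<comment> \<open>With k = j + 2 the exponents behind the indices k + 1 and k - 1 are j + 2 and
      j, so no subtraction is truncated.\<close>
    obtain j where "k = j + 2"
      using less_imp_Suc_add[OF \<open>k > 1\<close>] by auto
    then show ?thesis
      using P_recurrence_1[of j] \<open>m = 1\<close> assms(6,7) by (simp add: t0 u Ptilde_eq_P eq_divide_eq mult.commute)
  qed
  moreover have "Ptilde (k + 1) m t0 = Ptilde (k - 1) (m - 2) t0 - b\<^sup>2 * Ptilde (k - 1) m t0"
    if "m > 1" "k > 1"
  proof -
    obtain j n where "k = j + 2" "m = n + 2"
      using less_imp_Suc_add[OF \<open>k > 1\<close>] less_imp_Suc_add[OF \<open>m > 1\<close>] by auto
    then show ?thesis
      using P_recurrence[of j n] by (simp add: t0 Ptilde_eq_P)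
  qed
  moreover have "Ptilde 1 1 t0 = arsinh (t2 / \<bar>b\<bar>) - arsinh (t1 / \<bar>b\<bar>)" if "b \<noteq> 0"
    using P_arsinh[OF that] assms(6,7) by (simp add: t0 Ptilde_eq_P)
  moreover have "Ptilde 2 1 t0 = u2 - u1"
    using P_1_1 assms(6,7) by (simp add: t0 u Ptilde_eq_P)
  moreover have "Ptilde 1 3 t0 = 1 / b\<^sup>2 * (t2 / u2 - t1 / u1)" if "b \<noteq> 0"
    using P_0[of 1] that assms(6,7) by (simp add: t0 u Ptilde_eq_P eq_divide_eq mult.commute eval_nat_numeral)
  moreover have "Ptilde 2 3 t0 = 1 / u1 - 1 / u2"
    using P_1[of 1] assms(6,7) by (simp add: t0 u Ptilde_eq_P eval_nat_numeral)
  moreover have "Ptilde 1 5 t0 = 1 / (3 * b\<^sup>2) * (t2 / u2 ^ 3 - t1 / u1 ^ 3 + 2 * Ptilde 1 3 t0)"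
    if "b \<noteq> 0"
    using P_0[of 3] that assms(6,7) by (simp add: t0 u Ptilde_eq_P eq_divide_eq mult.commute eval_nat_numeral)
  moreover have "Ptilde 2 5 t0 = 1 / 3 * (1 / u1 ^ 3 - 1 / u2 ^ 3)"
    using P_1[of 3] assms(6,7) by (simp add: t0 u Ptilde_eq_P eval_nat_numeral)
  ultimately show ?thesis
    by blast
qed

end
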